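(* For any tree $T$, $\gamma_f^\infty(T)=\gamma_{\mathrm m}^\infty(T)$.
   Context: All graphs are finite, simple and undirected. $N(v)$ is the open neighbourhood and $N[v]=N(v)\cup\{v\}$ the closed neighbourhood of $v$. A fractional dominating function of $G=(V,E)$ is a function $w:V\to[0,\infty)$ with $\sum_{x\in N[v]}w(x)\ge 1$ for all $v\in V$; its total weight is $\sum_{x\in V}w(x)$. Fractional eternal domination. Fix $S$. The defender chooses a fractional dominating function $w_1$ of total weight at most $S$. In each round $i\ge 1$ the attacker, who may choose attacks adaptively, attacks a vertex $v_i\in V$, and the defender chooses amounts $m_{xy,i}\ge 0$ for all $x\in V$, $y\in N(x)$, with $\sum_{y\in N(x)}m_{xy,i}\le w_i(x)$, and sets $w_{i+1}(x)=w_i(x)-\sum_{y\in N(x)}m_{xy,i}+\sum_{y\in N(x)}m_{yx,i}$. It is required that $w_{i+1}$ be a fractional dominating function and $w_{i+1}(v_i)\ge 1$. If the defender can respond in this way to every infinite sequence of attacks, $G$ can be eternally $S$-fractionally dominated. $\gamma_f^\infty(G)$ is the infimum of all $S$ for which $G$ can be eternally $S$-fractionally dominated. m-eternal domination. The defender chooses $D_1\subseteq V$ (guard positions). In each round $i\ge1$ the attacker attacks a vertex $v_i\notin D_i$, and the defender replaces $D_i$ by a set $D_{i+1}$ with $v_i\in D_{i+1}$, by moving any number of guards, each to an adjacent vertex or staying put (i.e. there is a bijection $\varphi:D_i\to D_{i+1}$ with $\varphi(u)\in N[u]$). $\gamma_{\mathrm m}^\infty(G)$ is the minimum $|D_1|$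 for which the defender can respond to every infinite sequence of attacks. *)

theory Defs
  imports Complex_Main "Graph_Theory.Graph_Theory"
begin

text \<open>
  A finite simple undirected graph is a \<open>pair_graph\<close>: a finite, symmetric, loop-free set of
  ordered pairs over a finite vertex set, every edge being present in both directions.
\<close>

definition nbhd :: "'a pair_pre_digraph \<Rightarrow> 'a \<Rightarrow> 'a set" where
  "nbhd G v = {u. (v, u) \<in> parcs G}"

definition closed_nbhd :: "'a pair_pre_digraph \<Rightarrow> 'a \<Rightarrow> 'a set" where
  "closed_nbhd G v = insert v (nbhd G v)"

text \<open>
  The library's \<open>tree\<close> is not usable for undirected graphs: in a symmetric digraph every edge
  traversed back and forth is a (directed) cycle of length 2. The cycles of the undirected graph
  are those with at least three arcs. \<open>connected\<close> includes that there is at least one vertex.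
\<close>

definition undirected_tree :: "'a pair_pre_digraph \<Rightarrow> bool" where
  "undirected_tree G \<longleftrightarrow>
     pair_graph G \<and>
     Digraph_Component.connected (with_proj G) \<and>
     \<not> (\<exists>p. pre_digraph.cycle (with_proj G) p \<and> 3 \<le> length p)"


subsection \<open>Fractional eternal domination\<close>

definition frac_dominating :: "'a pair_pre_digraph \<Rightarrow> ('a \<Rightarrow> real) \<Rightarrow> bool" where
  "frac_dominating G w \<longleftrightarrow>
     (\<forall>x\<in>pverts G. 0 \<le> w x) \<and>
     (\<forall>v\<in>pverts G. 1 \<le> (\<Sum>x\<in>closed_nbhd G v. w x))"

definition frac_move :: "'a pair_pre_digraph \<Rightarrow> ('a \<Rightarrow> real) \<Rightarrow> ('a \<Rightarrow> real) \<Rightarrow> bool" where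
  "frac_move G w w' \<longleftrightarrow>
     (\<exists>m :: 'a \<Rightarrow> 'a \<Rightarrow> real.
        (\<forall>x\<in>pverts G. \<forall>y\<in>nbhd G x. 0 \<le> m x y) \<and>
        (\<forall>x\<in>pverts G. (\<Sum>y\<in>nbhd G x. m x y) \<le> w x) \<and>
        (\<forall>x\<in>pverts G. w' x = w x - (\<Sum>y\<in>nbhd G x. m x y) + (\<Sum>y\<in>nbhd G x. m y x)))"

text \<open>
  A defender strategy maps the list of all attacks made so far to the current position, so that
  it never depends on future attacks. For an attack sequence \<open>a\<close>, the position before the
  attack on \<open>a i\<close> is \<open>\<sigma> (map a [0..<i])\<close>; in particular \<open>\<sigma> []\<close> is the initial position.
\<close>

definition frac_eternally_dominable :: "'a pair_pre_digraph \<Rightarrow> real \<Rightarrow> bool" where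
  "frac_eternally_dominable G S \<longleftrightarrow>
     (\<exists>\<sigma> :: 'a list \<Rightarrow> 'a \<Rightarrow> real.
        frac_dominating G (\<sigma> []) \<and>
        (\<Sum>x\<in>pverts G. \<sigma> [] x) \<le> S \<and>
        (\<forall>a :: nat \<Rightarrow> 'a. (\<forall>i. a i \<in> pverts G) \<longrightarrow>
           (\<forall>i. frac_move G (\<sigma> (map a [0..<i])) (\<sigma> (map a [0..<Suc i])) \<and>
                frac_dominating G (\<sigma> (map a [0..<Suc i])) \<and>
                1 \<le> \<sigma> (map a [0..<Suc i]) (a i))))"

definition frac_eternal_domination_number :: "'a pair_pre_digraph \<Rightarrow> real" where
  "frac_eternal_domination_number G = Inf {S. frac_eternally_dominable G S}"


subsection \<open>m-eternal domination\<close>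

definition guard_move :: "'a pair_pre_digraph \<Rightarrow> 'a set \<Rightarrow> 'a set \<Rightarrow> bool" where
  "guard_move G D D' \<longleftrightarrow> (\<exists>\<phi>. bij_betw \<phi> D D' \<and> (\<forall>u\<in>D. \<phi> u \<in> closed_nbhd G u))"

text \<open>
  An attack must hit an unguarded vertex, so the defender only has to answer the \<open>i\<close>-th attack if
  it and all earlier attacks were of this kind. This also covers plays that stop because every
  vertex is guarded.
\<close>

definition m_eternally_dominable :: "'a pair_pre_digraph \<Rightarrow> nat \<Rightarrow> bool" where
  "m_eternally_dominable G k \<longleftrightarrow>
     (\<exists>\<sigma> :: 'a list \<Rightarrow> 'a set.
        \<sigma> [] \<subseteq> pverts G \<and>
        card (\<sigma> []) = k \<and>
        (\<forall>a :: nat \<Rightarrow> 'a. (\<forall>i. a i \<in> pverts G) \<longrightarrow>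
           (\<forall>i. (\<forall>j\<le>i. a j \<notin> \<sigma> (map a [0..<j])) \<longrightarrow>
                \<sigma> (map a [0..<Suc i]) \<subseteq> pverts G \<and>
                guard_move G (\<sigma> (map a [0..<i])) (\<sigma> (map a [0..<Suc i])) \<and>
                a i \<in> \<sigma> (map a [0..<Suc i]))))"

definition m_eternal_domination_number :: "'a pair_pre_digraph \<Rightarrow> nat" where
  "m_eternal_domination_number G = (LEAST k. m_eternally_dominable G k)"


text \<open>The infimum and the minimum are taken over nonempty sets, the infimum also over one that is
  bounded below, so neither is a default value.\<close>

lemma finite_closed_nbhd:
  assumes "pair_graph G"
  shows "finite (closed_nbhd G v)"
proof -
  interpret pair_graph G by fact
  have "nbhd G v \<subseteq> snd ` parcs G" by (force simp: nbhd_def)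
  then show ?thesis
    unfolding closed_nbhd_def by (meson finite.insertI finite_imageI pair_finite_arcs finite_subset)
qed

lemma frac_eternally_dominable_card:
  assumes "pair_graph G"
  shows "frac_eternally_dominable G (real (card (pverts G)))"
proof -
  have dom: "frac_dominating G (\<lambda>_. 1)"
  proof -
    have "1 \<le> card (closed_nbhd G v)" for v
      using finite_closed_nbhd[OF assms, of v] card_gt_0_iff[of "closed_nbhd G v"]
      by (auto simp: closed_nbhd_def Suc_le_eq)
    then show ?thesis
      unfolding frac_dominating_def
      by (simp del: One_nat_def)
  qed
  have "frac_move G (\<lambda>_. 1) (\<lambda>_. 1)"
    unfolding frac_move_def by (intro exI[of _ "\<lambda>_ _. 0"]) simp
  with dom show ?thesis
    unfolding frac_eternally_dominable_def by (intro exI[of _ "\<lambda>_ _. 1"]) simp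
qed

lemma bdd_below_frac_eternally_dominable: "bdd_below {S. frac_eternally_dominable G S}"
proof (rule bdd_belowI[of _ 0])
  fix S assume "S \<in> {S. frac_eternally_dominable G S}"
  then obtain w where "frac_dominating G w" "(\<Sum>x\<in>pverts G. w x) \<le> S"
    unfolding frac_eternally_dominable_def by blast
  then show "0 \<le> S"
    unfolding frac_dominating_def by (meson order_trans sum_nonneg)
qed

lemma m_eternally_dominable_card: "m_eternally_dominable G (card (pverts G))"
  unfolding m_eternally_dominable_def by (intro exI[of _ "\<lambda>_. pverts G"]) auto

end

theory Submission
  imports Defs
begin

text \<open>
  Both numbers drop by exactly one when suitable vertices are deleted at the end of a longest path,
  so they agree by induction. The induction runs over acyclic graphs that need not be connected,
  because deletions may disconnect the graph; it starts at the empty graph, where both numbers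
  are 0.

  A longest path shows that a nonempty acyclic graph has an isolated vertex or a vertex \<open>x\<close> all
  of whose neighbours, except possibly one vertex \<open>z\<close>, are leaves, at least one of them being
  a leaf (\<open>acyclic_graph_end\<close>). The set \<open>R\<close> to be deleted is the isolated vertex, or \<open>x\<close> together
  with its leaf if there is just one, or all leaves at \<open>x\<close> if there are at least two.

  Guards: one guard more than for \<open>G - R\<close> suffices for \<open>G\<close>. If \<open>R\<close> is a clique, the new guard stays
  inside \<open>R\<close> (\<open>m_eternally_dominable_add_clique\<close>). If \<open>R\<close> consists of neighbours of \<open>x\<close>, the star
  around \<open>x\<close> holds one guard more than \<open>x\<close> does in \<open>G - R\<close>, and \<open>x\<close> is always occupied
  (\<open>m_eternally_dominable_add_leaves\<close>).

  Weights: from a strategy for \<open>G\<close> one for \<open>G - R\<close> of total weight smaller by 1 is obtained by adding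
  the weight of \<open>R\<close>, less 1, to the only vertex \<open>c\<close> through which \<open>R\<close> is attached
  (\<open>frac_eternally_dominable_absorb\<close>). What \<open>R\<close> and \<open>c\<close> exchange becomes invisible.

  Finally, guards are special weights, so an m-eternal strategy with \<open>k\<close> guards is a fractional one
  of weight \<open>k\<close> (\<open>m_imp_frac_eternally_dominable\<close>). Hence the number \<open>n\<close> that the induction
  produces, which is attained by guards and is a lower bound for weights, equals both
  parameters.
\<close>

section \<open>Neighbourhoods and vertex deletion\<close>

lemma nbhd_subset_pverts: "pair_graph G \<Longrightarrow> nbhd G v \<subseteq> pverts G"
  using pair_wf_digraph.in_arcsD2 pair_graph_def pair_digraph_def pair_fin_digraph_def
  unfolding nbhd_def by fastforce

lemma nbhd_sym: "pair_graph G \<Longrightarrow> u \<in> nbhd G v \<longleftrightarrow> v \<in> nbhd G u"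
  unfolding nbhd_def
  by (auto simp: pair_graph_def pair_pseudo_graph_def dest: pair_sym_digraph.arcs_symmetric)

lemma nbhd_irrefl: "pair_graph G \<Longrightarrow> v \<notin> nbhd G v"
  unfolding nbhd_def
  by (auto simp: pair_graph_def pair_digraph_def dest: pair_loopfree_digraph.pair_no_loops)

lemma finite_pverts: "pair_graph G \<Longrightarrow> finite (pverts G)"
  by (simp add: pair_graph_def pair_digraph_def pair_fin_digraph.pair_finite_verts)

definition remove_verts :: "'a pair_pre_digraph \<Rightarrow> 'a set \<Rightarrow> 'a pair_pre_digraph" where
  "remove_verts G R =
     \<lparr>pverts = pverts G - R, parcs = {(u, v) \<in> parcs G. u \<notin> R \<and> v \<notin> R}\<rparr>"

lemma pverts_remove_verts [simp]: "pverts (remove_verts G R) = pverts G - R"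
  by (simp add: remove_verts_def)

lemma nbhd_remove_verts: "nbhd (remove_verts G R) v = (if v \<in> R then {} else nbhd G v - R)"
  by (auto simp: remove_verts_def nbhd_def)

lemma pair_graph_remove_verts:
  assumes "pair_graph G"
  shows "pair_graph (remove_verts G R)"
proof -
  interpret pair_graph G by fact
  show ?thesis
  proof
    show "finite (parcs (remove_verts G R))"
      by (rule finite_subset[OF _ pair_finite_arcs]) (auto simp: remove_verts_def)
    show "symmetric (with_proj (remove_verts G R))"
      using arcs_symmetric by (auto simp: symmetric_def remove_verts_def intro!: symI)
  qed (use in_arcsD1 in_arcsD2 pair_finite_verts no_loops' in \<open>auto simp: remove_verts_def\<close>)
qed

section \<open>Strategies as safe families of positions\<close>

text \<open>
  A set of positions is safe if from each member every attack can be answered by a move to another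
  member. Safe families replace strategies because they are transformed positionwise, without
  translating histories of attacks.
\<close>

definition frac_safe :: "'a pair_pre_digraph \<Rightarrow> ('a \<Rightarrow> real) set \<Rightarrow> bool" where
  "frac_safe G P \<longleftrightarrow>
     (\<forall>w\<in>P. (\<forall>x\<in>pverts G. 0 \<le> w x) \<and>
            (\<forall>v\<in>pverts G. \<exists>w'\<in>P. frac_move G w w' \<and> 1 \<le> w' v))"

definition m_safe :: "'a pair_pre_digraph \<Rightarrow> 'a set set \<Rightarrow> bool" where
  "m_safe G P \<longleftrightarrow>
     (\<forall>D\<in>P. D \<subseteq> pverts G \<and>
            (\<forall>v\<in>pverts G - D. \<exists>D'\<in>P. guard_move G D D' \<and> v \<in> D'))"

lemma map_extend:
  assumes "j \<le> length l"
  shows "map (\<lambda>i. if i < length l then l ! i else v) [0..<j] = take j l"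
  using assms by (intro nth_equalityI) auto

lemma m_eternally_dominable_iff_safe:
  "m_eternally_dominable G k \<longleftrightarrow> (\<exists>P. m_safe G P \<and> (\<exists>D\<in>P. card D = k))"
proof
  assume "m_eternally_dominable G k"
  then obtain \<sigma> where init: "\<sigma> [] \<subseteq> pverts G" "card (\<sigma> []) = k"
    and resp: "\<And>a i. (\<forall>i. a i \<in> pverts G) \<Longrightarrow> (\<forall>j\<le>i. a j \<notin> \<sigma> (map a [0..<j])) \<Longrightarrow>
        \<sigma> (map a [0..<Suc i]) \<subseteq> pverts G \<and>
        guard_move G (\<sigma> (map a [0..<i])) (\<sigma> (map a [0..<Suc i])) \<and> a i \<in> \<sigma> (map a [0..<Suc i])"
    unfolding m_eternally_dominable_def by blast
  \<comment> \<open>The strategy is only constrained on histories in which every attack hit an unguarded vertex.\<close>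
  define legal where
    "legal l \<longleftrightarrow> set l \<subseteq> pverts G \<and> (\<forall>j<length l. l ! j \<notin> \<sigma> (take j l))" for l
  have step: "legal (l @ [v]) \<and> \<sigma> (l @ [v]) \<subseteq> pverts G \<and> guard_move G (\<sigma> l) (\<sigma> (l @ [v]))
      \<and> v \<in> \<sigma> (l @ [v])" if "legal l" "v \<in> pverts G - \<sigma> l" for l v
  proof -
    define a where "a = (\<lambda>i. if i < length l then l ! i else v)"
    have a_take: "map a [0..<j] = take j l" if "j \<le> length l" for j
      unfolding a_def using that by (rule map_extend)
    have "map a [0..<Suc (length l)] = l @ [v]"
      using a_take[of "length l"] by (simp add: a_def)
    moreover have "\<forall>i. a i \<in> pverts G"
      using that by (auto simp: a_def legal_def)
    moreover have "\<forall>j\<le>length l. a j \<notin> \<sigma> (map a [0..<j])"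
      using that a_take by (auto simp: a_def legal_def)
    moreover have "legal (l @ [v])"
      using that by (auto simp: legal_def nth_append less_Suc_eq)
    ultimately show ?thesis
      using resp[of a "length l"] a_take[of "length l"] by (simp add: a_def)
  qed
  have legal_snoc: "legal l \<and> v \<in> pverts G - \<sigma> l" if "legal (l @ [v])" for l v
    using that unfolding legal_def by (auto simp: nth_append less_Suc_eq split: if_splits)
  have sub: "\<sigma> l \<subseteq> pverts G" if "legal l" for l
    using that init(1) step legal_snoc by (cases l rule: rev_cases) blast+
  have "m_safe G (\<sigma> ` Collect legal)"
    unfolding m_safe_def using sub step by blast
  moreover have "\<sigma> [] \<in> \<sigma> ` Collect legal"
    by (auto simp: legal_def)
  ultimately show "\<exists>P. m_safe G P \<and> (\<exists>D\<in>P. card D = k)"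
    using init by blast
next
  assume "\<exists>P. m_safe G P \<and> (\<exists>D\<in>P. card D = k)"
  then obtain P D0 where safe: "m_safe G P" and D0: "D0 \<in> P" "card D0 = k" by blast
  define step where "step D v =
    (if v \<in> pverts G - D then SOME D'. D' \<in> P \<and> guard_move G D D' \<and> v \<in> D' else D)" for D v
  have step: "step D v \<in> P \<and> guard_move G D (step D v) \<and> v \<in> step D v"
    if "D \<in> P" "v \<in> pverts G - D" for D v
  proof -
    have "\<exists>D'. D' \<in> P \<and> guard_move G D D' \<and> v \<in> D'"
      using safe that unfolding m_safe_def by blast
    from someI_ex[OF this] show ?thesis
      using that(2) unfolding step_def by simp
  qed
  then have in_P: "foldl step D0 l \<in> P" for l
    by (induction l rule: rev_induct) (use D0 in \<open>auto simp: step_def\<close>)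
  have "a i \<in> pverts G \<Longrightarrow> a i \<notin> foldl step D0 (map a [0..<i]) \<Longrightarrow>
      guard_move G (foldl step D0 (map a [0..<i])) (foldl step D0 (map a [0..<Suc i])) \<and>
      a i \<in> foldl step D0 (map a [0..<Suc i])" for a i
    using step[OF in_P] by simp
  moreover have "D0 \<subseteq> pverts G" "foldl step D0 l \<subseteq> pverts G" for l
    using D0 in_P safe unfolding m_safe_def by blast+
  ultimately show "m_eternally_dominable G k"
    unfolding m_eternally_dominable_def using D0
    by (intro exI[of _ "foldl step D0"]) (auto simp del: upt_Suc)
qed

text \<open>
  With flows extended by 0 to all pairs of vertices, every sum ranges over the whole vertex set,
  so that double sums over blocks of vertices can be swapped.
\<close>

lemma frac_move_iff_flow:
  assumes "pair_graph G"
  shows "frac_move G w w' \<longleftrightarrow>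
    (\<exists>f. (\<forall>x y. 0 \<le> f x y) \<and> (\<forall>x y. y \<notin> nbhd G x \<longrightarrow> f x y = 0) \<and>
      (\<forall>x\<in>pverts G. (\<Sum>y\<in>pverts G. f x y) \<le> w x \<and>
         w' x = w x - (\<Sum>y\<in>pverts G. f x y) + (\<Sum>y\<in>pverts G. f y x)))"
    (is "_ = ?R")
proof
  assume "frac_move G w w'"
  then obtain m where m: "\<And>x y. x \<in> pverts G \<Longrightarrow> y \<in> nbhd G x \<Longrightarrow> 0 \<le> m x y"
    "\<And>x. x \<in> pverts G \<Longrightarrow> (\<Sum>y\<in>nbhd G x. m x y) \<le> w x"
    "\<And>x. x \<in> pverts G \<Longrightarrow> w' x = w x - (\<Sum>y\<in>nbhd G x. m x y) + (\<Sum>y\<in>nbhd G x. m y x)"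
    unfolding frac_move_def by blast
  define f where "f x y = (if y \<in> nbhd G x then m x y else 0)" for x y
  have "(\<Sum>y\<in>pverts G. f x y) = (\<Sum>y\<in>nbhd G x. m x y)"
    "(\<Sum>y\<in>pverts G. f y x) = (\<Sum>y\<in>nbhd G x. m y x)" for x
    using nbhd_subset_pverts[OF assms] finite_pverts[OF assms] nbhd_sym[OF assms]
    by (auto simp: f_def intro!: sum.mono_neutral_cong_right)
  moreover have "0 \<le> f x y" for x y
    using m(1)[of x y] nbhd_sym[OF assms, of y x] nbhd_subset_pverts[OF assms, of y] by (auto simp: f_def)
  ultimately show ?R
    using m by (intro exI[of _ f]) (simp add: f_def)
next
  assume ?R
  then obtain f where f: "\<And>x y. 0 \<le> f x y" "\<And>x y. y \<notin> nbhd G x \<Longrightarrow> f x y = 0"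
    "\<And>x. x \<in> pverts G \<Longrightarrow> (\<Sum>y\<in>pverts G. f x y) \<le> w x"
    "\<And>x. x \<in> pverts G \<Longrightarrow>
       w' x = w x - (\<Sum>y\<in>pverts G. f x y) + (\<Sum>y\<in>pverts G. f y x)"
    by blast
  have "(\<Sum>y\<in>pverts G. f x y) = (\<Sum>y\<in>nbhd G x. f x y)"
    "(\<Sum>y\<in>pverts G. f y x) = (\<Sum>y\<in>nbhd G x. f y x)" for x
    using nbhd_subset_pverts[OF assms] finite_pverts[OF assms] nbhd_sym[OF assms] f(2)
    by (auto intro!: sum.mono_neutral_cong_right)
  then show "frac_move G w w'"
    unfolding frac_move_def using f by (intro exI[of _ f]) simp
qed

text \<open>
  If \<open>v\<close> has weight 1 after a move, this weight was in the closed neighbourhood of \<open>v\<close> before it;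
  so the ability to answer an attack on any vertex implies domination.
\<close>

lemma frac_safe_dominating:
  assumes G: "pair_graph G" and "frac_safe G P" "w \<in> P"
  shows "frac_dominating G w"
  unfolding frac_dominating_def
proof (intro conjI ballI)
  show nonneg: "0 \<le> w x" if "x \<in> pverts G" for x
    using assms that unfolding frac_safe_def by blast
  fix v assume v: "v \<in> pverts G"
  then obtain w' where w': "frac_move G w w'" "1 \<le> w' v"
    using assms unfolding frac_safe_def by blast
  then obtain m where m: "\<And>x y. x \<in> pverts G \<Longrightarrow> y \<in> nbhd G x \<Longrightarrow> 0 \<le> m x y"
    "\<And>x. x \<in> pverts G \<Longrightarrow> (\<Sum>y\<in>nbhd G x. m x y) \<le> w x"
    "\<And>x. x \<in> pverts G \<Longrightarrow> w' x = w x - (\<Sum>y\<in>nbhd G x. m x y) + (\<Sum>y\<in>nbhd G x. m y x)"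
    unfolding frac_move_def by blast
  have fin: "finite (nbhd G x)" for x
    using finite_pverts[OF G] nbhd_subset_pverts[OF G] by (rule finite_subset[rotated])
  have "(\<Sum>y\<in>nbhd G v. m y v) \<le> (\<Sum>y\<in>nbhd G v. w y)"
  proof (rule sum_mono)
    fix y assume "y \<in> nbhd G v"
    then have y: "y \<in> pverts G" "v \<in> nbhd G y"
      using nbhd_subset_pverts[OF G] nbhd_sym[OF G] by auto
    then have "m y v \<le> (\<Sum>u\<in>nbhd G y. m y u)"
      using fin m(1) by (intro member_le_sum) auto
    then show "m y v \<le> w y"
      using m(2) y(1) by fastforce
  qed
  moreover have "0 \<le> (\<Sum>y\<in>nbhd G v. m v y)"
    using m(1) v by (simp add: sum_nonneg)
  moreover have "(\<Sum>x\<in>closed_nbhd G v. w x) = w v + (\<Sum>y\<in>nbhd G v. w y)"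
    using fin nbhd_irrefl[OF G] by (simp add: closed_nbhd_def)
  ultimately show "1 \<le> (\<Sum>x\<in>closed_nbhd G v. w x)"
    using m(3)[OF v] w'(2) by linarith
qed

lemma frac_eternally_dominable_iff_safe:
  assumes G: "pair_graph G"
  shows "frac_eternally_dominable G S \<longleftrightarrow>
    (\<exists>P. frac_safe G P \<and> (\<exists>w\<in>P. (\<Sum>x\<in>pverts G. w x) \<le> S))"
proof
  assume "frac_eternally_dominable G S"
  then obtain \<sigma> where init: "frac_dominating G (\<sigma> [])" "(\<Sum>x\<in>pverts G. \<sigma> [] x) \<le> S"
    and resp: "\<And>a i. (\<forall>i. a i \<in> pverts G) \<Longrightarrow>
        frac_move G (\<sigma> (map a [0..<i])) (\<sigma> (map a [0..<Suc i])) \<and>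
        frac_dominating G (\<sigma> (map a [0..<Suc i])) \<and> 1 \<le> \<sigma> (map a [0..<Suc i]) (a i)"
    unfolding frac_eternally_dominable_def by blast
  have step: "frac_move G (\<sigma> l) (\<sigma> (l @ [v])) \<and> frac_dominating G (\<sigma> (l @ [v]))
      \<and> 1 \<le> \<sigma> (l @ [v]) v" if "set l \<subseteq> pverts G" "v \<in> pverts G" for l v
  proof -
    define a where "a = (\<lambda>i. if i < length l then l ! i else v)"
    have "map a [0..<length l] = l"
      unfolding a_def by (simp only: map_extend take_all order_refl)
    then show ?thesis
      using resp[of a "length l"] that by (simp add: a_def nth_mem subset_iff)
  qed
  have "frac_dominating G (\<sigma> l)" if "set l \<subseteq> pverts G" for l
    using that by (cases l rule: rev_cases) (use init step in auto)
  then have "0 \<le> \<sigma> l x" if "set l \<subseteq> pverts G" "x \<in> pverts G" for l x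
    using that unfolding frac_dominating_def by blast
  moreover have "\<exists>l'. set l' \<subseteq> pverts G \<and> frac_move G (\<sigma> l) (\<sigma> l') \<and> 1 \<le> \<sigma> l' v"
    if "set l \<subseteq> pverts G" "v \<in> pverts G" for l v
    using step[OF that] that by (intro exI[of _ "l @ [v]"]) auto
  ultimately have "frac_safe G (\<sigma> ` {l. set l \<subseteq> pverts G})"
    unfolding frac_safe_def by auto
  moreover have "\<sigma> [] \<in> \<sigma> ` {l. set l \<subseteq> pverts G}" by auto
  ultimately show "\<exists>P. frac_safe G P \<and> (\<exists>w\<in>P. (\<Sum>x\<in>pverts G. w x) \<le> S)"
    using init by blast
next
  assume "\<exists>P. frac_safe G P \<and> (\<exists>w\<in>P. (\<Sum>x\<in>pverts G. w x) \<le> S)"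
  then obtain P w0 where safe: "frac_safe G P" and w0: "w0 \<in> P" "(\<Sum>x\<in>pverts G. w0 x) \<le> S"
    by blast
  define step where "step w v =
    (if v \<in> pverts G then SOME w'. w' \<in> P \<and> frac_move G w w' \<and> 1 \<le> w' v else w)" for w v
  have step: "step w v \<in> P \<and> frac_move G w (step w v) \<and> 1 \<le> step w v v"
    if "w \<in> P" "v \<in> pverts G" for w v
  proof -
    have "\<exists>w'. w' \<in> P \<and> frac_move G w w' \<and> 1 \<le> w' v"
      using safe that unfolding frac_safe_def by blast
    from someI_ex[OF this] show ?thesis
      using that(2) unfolding step_def by simp
  qed
  then have in_P: "foldl step w0 l \<in> P" for l
    by (induction l rule: rev_induct) (use w0 in \<open>auto simp: step_def\<close>)
  have "a i \<in> pverts G \<Longrightarrow>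
      frac_move G (foldl step w0 (map a [0..<i])) (foldl step w0 (map a [0..<Suc i])) \<and>
      1 \<le> foldl step w0 (map a [0..<Suc i]) (a i)" for a i
    using step[OF in_P] by simp
  moreover have "frac_dominating G w0" "frac_dominating G (foldl step w0 l)" for l
    using frac_safe_dominating[OF G safe] w0(1) in_P by blast+
  ultimately show "frac_eternally_dominable G S"
    unfolding frac_eternally_dominable_def using w0(2)
    by (intro exI[of _ "foldl step w0"]) (auto simp del: upt_Suc)
qed

text \<open>
  The indicator functions of a safe family of guard sets form a safe family of weights. An attack
  on an occupied vertex, which does not arise in the m-eternal game, is answered by standing still.
\<close>

lemma m_imp_frac_eternally_dominable:
  assumes G: "pair_graph G" and "m_eternally_dominable G k"
  shows "frac_eternally_dominable G (real k)"
proof -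
  obtain P D0 where safe: "m_safe G P" and D0: "D0 \<in> P" "card D0 = k"
    using assms(2) unfolding m_eternally_dominable_iff_safe by blast
  define ind :: "'a set \<Rightarrow> 'a \<Rightarrow> real" where "ind D x = of_bool (x \<in> D)" for D x
  have sub: "D \<subseteq> pverts G" if "D \<in> P" for D
    using safe that unfolding m_safe_def by blast
  have move: "frac_move G (ind D) (ind D')"
    if "guard_move G D D'" "D \<subseteq> pverts G" "D' \<subseteq> pverts G" for D D'
  proof -
    obtain \<phi> where \<phi>: "bij_betw \<phi> D D'" "\<And>u. u \<in> D \<Longrightarrow> \<phi> u \<in> closed_nbhd G u"
      using \<open>guard_move G D D'\<close> unfolding guard_move_def by blast
    define f :: "'a \<Rightarrow> 'a \<Rightarrow> real" where "f x y = of_bool (x \<in> D \<and> y = \<phi> x \<and> y \<noteq> x)" for x y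
    have out: "(\<Sum>y\<in>pverts G. f x y) = of_bool (x \<in> D \<and> \<phi> x \<noteq> x)" for x
    proof -
      have "(\<Sum>y\<in>pverts G. f x y) =
          (\<Sum>y\<in>pverts G. if y = \<phi> x then of_bool (x \<in> D \<and> \<phi> x \<noteq> x) else 0)"
        by (rule sum.cong) (auto simp: f_def)
      also have "\<dots> = of_bool (x \<in> D \<and> \<phi> x \<noteq> x)"
        using \<phi>(1) that(3) finite_pverts[OF G] by (auto dest: bij_betwE)
      finally show ?thesis .
    qed
    have "in": "(\<Sum>y\<in>pverts G. f y x) = of_bool (x \<in> D' \<and> \<not> (x \<in> D \<and> \<phi> x = x))" for x
    proof (cases "x \<in> D'")
      case True
      define u where "u = the_inv_into D \<phi> x"
      have u: "u \<in> D" "\<phi> u = x"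
        using True \<phi>(1) the_inv_into_into[of \<phi> D x D] f_the_inv_into_f[of \<phi> D x]
        by (auto simp: u_def bij_betw_def)
      have uniq: "y = u" if "y \<in> D" "\<phi> y = x" for y
        using inj_onD[of \<phi> D y u] that u \<phi>(1) by (simp add: bij_betw_def)
      have "(\<Sum>y\<in>pverts G. f y x) = (\<Sum>y\<in>pverts G. if y = u then of_bool (x \<noteq> u) else 0)"
      proof (rule sum.cong)
        fix y
        show "f y x = (if y = u then of_bool (x \<noteq> u) else 0)"
        proof (cases "y = u")
          case False
          then have "\<not> (y \<in> D \<and> x = \<phi> y)"
            using uniq[of y] by metis
          with False show ?thesis
            unfolding f_def by auto
        qed (simp add: f_def u)
      qed simp
      also have "\<dots> = of_bool (x \<noteq> u)"
        using u(1) that(2) finite_pverts[OF G] by auto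
      finally have sum: "(\<Sum>y\<in>pverts G. f y x) = of_bool (x \<noteq> u)" .
      show ?thesis
      proof -
        have "x \<in> D \<and> \<phi> x = x \<longleftrightarrow> x = u"
          using u uniq[of x] by metis
        then show ?thesis
          using True sum by simp
      qed
    next
      case False
      then have "f y x = 0" for y
        using \<phi>(1) by (auto simp: f_def dest: bij_betwE)
      with False show ?thesis by simp
    qed
    have "ind D' x = ind D x - (\<Sum>y\<in>pverts G. f x y) + (\<Sum>y\<in>pverts G. f y x)" for x
      unfolding out "in" ind_def using bij_betw_apply[OF \<phi>(1), of x] by (cases "\<phi> x = x") auto
    moreover have "(\<Sum>y\<in>pverts G. f x y) \<le> ind D x" for x
      unfolding out ind_def by auto
    moreover have "y \<notin> nbhd G x \<longrightarrow> f x y = 0" for x y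
      using \<phi>(2)[of x] by (auto simp: f_def closed_nbhd_def)
    moreover have "0 \<le> f x y" for x y
      by (simp add: f_def)
    ultimately show ?thesis
      unfolding frac_move_iff_flow[OF G] by blast
  qed
  have stay: "frac_move G w w" if "\<forall>x\<in>pverts G. 0 \<le> w x" for w :: "'a \<Rightarrow> real"
    using that unfolding frac_move_def by (intro exI[of _ "\<lambda>_ _. 0"]) simp
  have "\<exists>D'\<in>P. frac_move G (ind D) (ind D') \<and> 1 \<le> ind D' v" if D: "D \<in> P" and v: "v \<in> pverts G" for D v
  proof (cases "v \<in> D")
    case True
    then show ?thesis
      using D stay[of "ind D"] by (intro bexI[of _ D]) (auto simp: ind_def)
  next
    case False
    then have "v \<in> pverts G - D"
      using v by simp
    then obtain D' where "D' \<in> P" "guard_move G D D'" "v \<in> D'"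
      using safe D unfolding m_safe_def by meson
    moreover from this have "frac_move G (ind D) (ind D')"
      using move sub D by blast
    moreover have "1 \<le> ind D' v"
      using \<open>v \<in> D'\<close> by (simp add: ind_def)
    ultimately show ?thesis by blast
  qed
  then have "frac_safe G (ind ` P)"
    unfolding frac_safe_def by (auto simp: ind_def)
  moreover have "(\<Sum>x\<in>pverts G. ind D0 x) = real k"
    using sub[OF D0(1)] D0(2) finite_pverts[OF G] by (simp add: ind_def Int_absorb1)
  ultimately show ?thesis
    unfolding frac_eternally_dominable_iff_safe[OF G] using D0(1) by (metis imageI order_refl)
qed

section \<open>Lower bounds for weights\<close>

text \<open>
  Deleting \<open>R\<close> moves its weight to \<open>c\<close>, except for the unit that \<open>R\<close> is charged for.
\<close>

definition absorb :: "'a set \<Rightarrow> 'a \<Rightarrow> ('a \<Rightarrow> real) \<Rightarrow> 'a \<Rightarrow> real" where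
  "absorb R c w u = (if u = c then w c + sum w R - 1 else w u)"

text \<open>
  A flow in \<open>G\<close> restricts to the rest of the graph: what passes between \<open>R\<close> and \<open>c\<close> does not change
  the absorbed weight of \<open>c\<close>. The issue is whether \<open>c\<close> has as much weight as it sends out. If \<open>R\<close>
  has weight at least 1, then absorbing does not lower the weight of \<open>c\<close>. If \<open>c\<close> has only one
  neighbour outside \<open>R\<close>, then opposite flows on that edge are cancelled; \<open>c\<close> now either sends out
  nothing or receives nothing, and in the latter case its outflow is its loss of weight, which is
  at most its weight because the final weight is nonnegative.
\<close>

lemma frac_move_absorb:
  assumes G: "pair_graph G" and R: "R \<subseteq> pverts G" and c: "c \<in> pverts G - R"
    and nb: "\<And>r. r \<in> R \<Longrightarrow> nbhd G r \<subseteq> insert c R"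
    and heavy_or_single: "1 \<le> sum w R \<or> (\<exists>z. nbhd G c \<subseteq> insert z R)"
    and nonneg: "0 \<le> absorb R c w c" "0 \<le> absorb R c w' c"
    and move: "frac_move G w w'"
  shows "frac_move (remove_verts G R) (absorb R c w) (absorb R c w')"
proof -
  obtain f where f: "\<And>x y. 0 \<le> f x y" "\<And>x y. y \<notin> nbhd G x \<Longrightarrow> f x y = 0"
    "\<And>x. x \<in> pverts G \<Longrightarrow> (\<Sum>y\<in>pverts G. f x y) \<le> w x"
    "\<And>x. x \<in> pverts G \<Longrightarrow>
       w' x = w x - (\<Sum>y\<in>pverts G. f x y) + (\<Sum>y\<in>pverts G. f y x)"
    using move unfolding frac_move_iff_flow[OF G] by blast
  let ?V = "pverts G - R"
  have finV: "finite ?V"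
    using finite_pverts[OF G] by simp
  \<comment> \<open>The flow \<open>g\<close> below has opposite directions cancelled; its net inflow at each vertex is that of \<open>f\<close>.\<close>
  define net where "net x = (\<Sum>y\<in>?V. f y x) - (\<Sum>y\<in>?V. f x y)" for x
  define g where "g x y = (if x \<in> ?V \<and> y \<in> ?V then max 0 (f x y - f y x) else 0)" for x y
  have split: "(\<Sum>y\<in>pverts G. h y) = sum h R + (\<Sum>y\<in>?V. h y)" for h :: "'a \<Rightarrow> real"
    using sum.subset_diff[OF R finite_pverts[OF G], of h] by simp
  have cross: "f x r = 0" "f r x = 0" if "x \<in> ?V" "x \<noteq> c" "r \<in> R" for x r
    using that nb[of r] f(2) nbhd_sym[OF G, of x r] by auto
  have net_g: "(\<Sum>y\<in>?V. g y x) - (\<Sum>y\<in>?V. g x y) = net x" if "x \<in> ?V" for x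
    unfolding net_def sum_subtractf[symmetric]
    by (rule sum.cong) (use that in \<open>auto simp: g_def\<close>)
  have out_g: "(\<Sum>y\<in>?V. g x y) \<le> w x" if "x \<in> ?V" for x
  proof -
    have "(\<Sum>y\<in>?V. g x y) \<le> (\<Sum>y\<in>?V. f x y)"
      using f(1) by (intro sum_mono) (auto simp: g_def)
    also have "\<dots> \<le> (\<Sum>y\<in>pverts G. f x y)"
      using f(1) finite_pverts[OF G] by (intro sum_mono2) auto
    also have "\<dots> \<le> w x"
      using f(3) that by simp
    finally show ?thesis .
  qed
  have net_outside: "w' x = w x + net x" if "x \<in> ?V" "x \<noteq> c" for x
  proof -
    have "(\<Sum>r\<in>R. f x r) = 0" "(\<Sum>r\<in>R. f r x) = 0"
      using cross that by (auto intro!: sum.neutral)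
    then show ?thesis
      using f(4)[of x] that unfolding net_def split by simp
  qed
  have net_c: "absorb R c w' c = absorb R c w c + net c"
  proof -
    have zero: "(\<Sum>r\<in>R. \<Sum>y\<in>?V. f r y) = (\<Sum>r\<in>R. f r c)"
      "(\<Sum>r\<in>R. \<Sum>y\<in>?V. f y r) = (\<Sum>r\<in>R. f c r)"
    proof -
      show "(\<Sum>r\<in>R. \<Sum>y\<in>?V. f r y) = (\<Sum>r\<in>R. f r c)"
      proof (rule sum.cong)
        fix r assume "r \<in> R"
        then have "(\<Sum>y\<in>?V. f r y) = (\<Sum>y\<in>{c}. f r y)"
          using c finV cross by (intro sum.mono_neutral_right) auto
        then show "(\<Sum>y\<in>?V. f r y) = f r c" by simp
      qed simp
      show "(\<Sum>r\<in>R. \<Sum>y\<in>?V. f y r) = (\<Sum>r\<in>R. f c r)"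
      proof (rule sum.cong)
        fix r assume "r \<in> R"
        then have "(\<Sum>y\<in>?V. f y r) = (\<Sum>y\<in>{c}. f y r)"
          using c finV cross by (intro sum.mono_neutral_right) auto
        then show "(\<Sum>y\<in>?V. f y r) = f c r" by simp
      qed simp
    qed
    have "sum w' R = (\<Sum>r\<in>R. w r - (\<Sum>y\<in>pverts G. f r y) + (\<Sum>y\<in>pverts G. f y r))"
      using R f(4) by (intro sum.cong) auto
    also have "\<dots> = sum w R - (\<Sum>r\<in>R. f r c) + (\<Sum>r\<in>R. f c r)"
      unfolding split sum.distrib sum_subtractf zero using sum.swap[of "\<lambda>r y. f r y" R R] by simp
    finally show ?thesis
      using f(4)[of c] c unfolding net_def split absorb_def by simp
  qed
  have out_c: "(\<Sum>y\<in>?V. g c y) \<le> absorb R c w c"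
    using heavy_or_single
  proof
    assume "1 \<le> sum w R"
    then show ?thesis
      using out_g[of c] c by (simp add: absorb_def)
  next
    assume "\<exists>z. nbhd G c \<subseteq> insert z R"
    then obtain z where z: "nbhd G c \<subseteq> insert z R" ..
    have zero: "f c y = 0" "f y c = 0" if "y \<in> ?V" "y \<noteq> z" for y
      using that z f(2) nbhd_sym[OF G, of y c] by auto
    show ?thesis
    proof (cases "z \<in> ?V")
      case True
      have single: "(\<Sum>y\<in>?V. h y) = h z" if "\<And>y. y \<in> ?V - {z} \<Longrightarrow> h y = 0" for h :: "'a \<Rightarrow> real"
        using sum.mono_neutral_right[of ?V "{z}" h] that finV True by simp
      have "(\<Sum>y\<in>?V. f y c) = f z c" "(\<Sum>y\<in>?V. f c y) = f c z"
        by (rule single, use zero in auto)+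
      moreover have "(\<Sum>y\<in>?V. g c y) = max 0 (f c z - f z c)"
        using single[of "g c"] zero True c by (auto simp: g_def)
      ultimately show ?thesis
        using nonneg net_c unfolding net_def by simp
    next
      case False
      then have "g c y = 0" if "y \<in> ?V" for y
        using that zero[of y] by (cases "y = z") (auto simp: g_def)
      then have "(\<Sum>y\<in>?V. g c y) = 0"
        by simp
      then show ?thesis
        using nonneg by simp
    qed
  qed
  show ?thesis
    unfolding frac_move_iff_flow[OF pair_graph_remove_verts[OF G]] pverts_remove_verts
  proof (intro exI[of _ g] conjI allI ballI impI)
    show "0 \<le> g x y" for x y
      by (simp add: g_def)
    show "g x y = 0" if "y \<notin> nbhd (remove_verts G R) x" for x y
      using that f(2) nbhd_sym[OF G, of y x] by (auto simp: g_def nbhd_remove_verts split: if_splits)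
    fix x assume x: "x \<in> ?V"
    show "(\<Sum>y\<in>?V. g x y) \<le> absorb R c w x"
      using out_c out_g[OF x] by (cases "x = c") (auto simp: absorb_def)
    have "absorb R c w' x = absorb R c w x + net x"
      using net_c net_outside[OF x] by (cases "x = c") (auto simp: absorb_def)
    then show "absorb R c w' x = absorb R c w x - (\<Sum>y\<in>?V. g x y) + (\<Sum>y\<in>?V. g y x)"
      using net_g[OF x] by simp
  qed
qed

text \<open>
  Attacks outside \<open>R\<close> are answered as in \<open>G\<close>, with one exception: an attack on \<open>c\<close> in the smaller
  graph is treated as an attack on \<open>b\<close> in \<open>G\<close>, chosen such that the answer puts weight at least 2
  on \<open>R\<close> and \<open>c\<close> together, which leaves 1 at \<open>c\<close> after the deletion. The vertex \<open>y\<close>, whose closed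
  neighbourhood always carries weight 1, keeps the absorbed weight nonnegative.
\<close>

lemma frac_eternally_dominable_absorb:
  assumes G: "pair_graph G" and R: "R \<subseteq> pverts G" and c: "c \<in> pverts G - R"
    and nb: "\<And>r. r \<in> R \<Longrightarrow> nbhd G r \<subseteq> insert c R"
    and y: "y \<in> R" "closed_nbhd G y \<subseteq> insert c R"
    and heavy_or_single: "closed_nbhd G y \<subseteq> R \<or> (\<exists>z. nbhd G c \<subseteq> insert z R)"
    and b: "b \<in> pverts G"
    and two: "\<And>w. frac_dominating G w \<Longrightarrow> 1 \<le> w b \<Longrightarrow> 2 \<le> w c + sum w R"
    and dom: "frac_eternally_dominable G S"
  shows "frac_eternally_dominable (remove_verts G R) (S - 1)"
proof -
  let ?H = "remove_verts G R"
  obtain P w0 where safe: "frac_safe G P" and w0: "w0 \<in> P" "(\<Sum>x\<in>pverts G. w0 x) \<le> S"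
    using dom unfolding frac_eternally_dominable_iff_safe[OF G] by blast
  have finR: "finite R"
    using finite_pverts[OF G] R finite_subset by auto
  have P_dom: "frac_dominating G w" if "w \<in> P" for w
    using frac_safe_dominating[OF G safe that] .
  have P_nonneg: "0 \<le> w x" if "w \<in> P" "x \<in> pverts G" for w x
    using safe that unfolding frac_safe_def by blast
  have closed_sum: "1 \<le> sum w B"
    if "w \<in> P" "closed_nbhd G y \<subseteq> B" "B \<subseteq> pverts G" for w B
  proof -
    have "1 \<le> sum w (closed_nbhd G y)"
      using P_dom[OF that(1)] y(1) R unfolding frac_dominating_def by auto
    also have "\<dots> \<le> sum w B"
      using that P_nonneg finite_subset[OF that(3) finite_pverts[OF G]]
      by (intro sum_mono2) auto
    finally show ?thesis .
  qed
  have c_nonneg: "0 \<le> absorb R c w c" if "w \<in> P" for w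
    using closed_sum[OF that y(2)] R c finR by (simp add: absorb_def)
  have move: "frac_move ?H (absorb R c w) (absorb R c w')"
    if "w \<in> P" "w' \<in> P" "frac_move G w w'" for w w'
    using frac_move_absorb[OF G R c nb _ c_nonneg c_nonneg that(3)]
      heavy_or_single closed_sum[OF that(1) _ R] that(1,2) by blast
  have "frac_safe ?H (absorb R c ` P)"
    unfolding frac_safe_def pverts_remove_verts
  proof (intro ballI conjI)
    fix u assume "u \<in> absorb R c ` P"
    then obtain w where w: "w \<in> P" "u = absorb R c w" by blast
    show "0 \<le> u x" if "x \<in> pverts G - R" for x
      using c_nonneg[OF w(1)] P_nonneg[OF w(1), of x] that w(2)
      by (cases "x = c") (auto simp: absorb_def)
    fix v assume v: "v \<in> pverts G - R"
    have "\<exists>w'\<in>P. frac_move G w w' \<and> 1 \<le> absorb R c w' v"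
    proof (cases "v = c")
      case True
      obtain w' where "w' \<in> P" "frac_move G w w'" "1 \<le> w' b"
        using safe w(1) b unfolding frac_safe_def by blast
      then show ?thesis
        using True two[OF P_dom, of w'] by (intro bexI[of _ w']) (auto simp: absorb_def)
    next
      case False
      obtain w' where "w' \<in> P" "frac_move G w w'" "1 \<le> w' v"
        using safe w(1) v unfolding frac_safe_def by blast
      then show ?thesis
        using False by (intro bexI[of _ w']) (auto simp: absorb_def)
    qed
    then show "\<exists>u'\<in>absorb R c ` P. frac_move ?H u u' \<and> 1 \<le> u' v"
      using move w by blast
  qed
  moreover have "(\<Sum>x\<in>pverts G - R. absorb R c w0 x) \<le> S - 1"
  proof -
    have fin: "finite (pverts G - R)"
      using finite_pverts[OF G] by simp
    have "(\<Sum>x\<in>pverts G - R. absorb R c w0 x) =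
        (\<Sum>x\<in>pverts G - R. w0 x + (if x = c then sum w0 R - 1 else 0))"
      by (rule sum.cong) (auto simp: absorb_def)
    also have "\<dots> = (\<Sum>x\<in>pverts G - R. w0 x) + sum w0 R - 1"
      using c fin by (simp add: sum.distrib)
    also have "\<dots> = (\<Sum>x\<in>pverts G. w0 x) - 1"
      using sum.subset_diff[OF R finite_pverts[OF G], of w0] by simp
    finally show ?thesis
      using w0(2) by simp
  qed
  ultimately show ?thesis
    unfolding frac_eternally_dominable_iff_safe[OF pair_graph_remove_verts[OF G]] pverts_remove_verts
    using w0(1) by blast
qed

text \<open>
  Here \<open>R\<close> contains a closed neighbourhood and hence always has weight 1, so an attack on \<open>c\<close> can
  be taken literally. If \<open>z\<close> is not a remaining vertex, nothing connects \<open>R\<close> with the rest of the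
  graph, and any remaining vertex can serve as \<open>c\<close>; if none remains, it suffices that the total
  weight was at least 1.
\<close>

lemma frac_eternally_dominable_remove_end:
  assumes G: "pair_graph G" and R: "R \<subseteq> pverts G"
    and y: "y \<in> R" "nbhd G y \<subseteq> R"
    and nb: "\<And>r. r \<in> R \<Longrightarrow> nbhd G r \<subseteq> insert z R"
    and dom: "frac_eternally_dominable G S"
  shows "frac_eternally_dominable (remove_verts G R) (S - 1)"
proof -
  have cl: "closed_nbhd G y \<subseteq> R"
    using y by (auto simp: closed_nbhd_def)
  have heavy: "1 \<le> sum w R" if "frac_dominating G w" for w
  proof -
    have "1 \<le> sum w (closed_nbhd G y)"
      using that y(1) R unfolding frac_dominating_def by auto
    also have "\<dots> \<le> sum w R"
      using that cl R finite_subset[OF R finite_pverts[OF G]] unfolding frac_dominating_def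
      by (intro sum_mono2) auto
    finally show ?thesis .
  qed
  show ?thesis
  proof (cases "pverts G - R = {}")
    case True
    obtain P w0 where P: "frac_safe G P" and w0: "w0 \<in> P" "(\<Sum>x\<in>pverts G. w0 x) \<le> S"
      using dom unfolding frac_eternally_dominable_iff_safe[OF G] by blast
    have "1 \<le> S"
      using heavy[OF frac_safe_dominating[OF G P w0(1)]] w0(2) True R
      by (metis Diff_eq_empty_iff order_trans subset_antisym)
    moreover have "frac_safe (remove_verts G R) {w0}"
      unfolding frac_safe_def pverts_remove_verts True by simp
    ultimately show ?thesis
      unfolding frac_eternally_dominable_iff_safe[OF pair_graph_remove_verts[OF G]]
        pverts_remove_verts True
      by (intro exI[of _ "{w0}"]) simp
  next
    case False
    then obtain c where c: "c \<in> pverts G - R" "z \<in> pverts G - R \<Longrightarrow> c = z" by blast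
    have nb': "nbhd G r \<subseteq> insert c R" if "r \<in> R" for r
      using nb[OF that] nbhd_subset_pverts[OF G, of r] c(2) by auto
    show ?thesis
    proof (rule frac_eternally_dominable_absorb[OF G R c(1) nb' y(1) _ _ _ _ dom])
      show "2 \<le> w c + sum w R" if "frac_dominating G w" "1 \<le> w c" for w
        using heavy[OF that(1)] that(2) by simp
    qed (use cl c in auto)
  qed
qed

text \<open>
  Two leaves are what makes the charge of 1 possible: an answer to an attack on \<open>l2\<close> has weight 1 at
  \<open>l2\<close> and, as it dominates \<open>l1\<close>, another 1 on \<open>l1\<close> and \<open>x\<close> together. So attacks on \<open>x\<close> in the
  smaller graph are treated as attacks on \<open>l2\<close>.
\<close>

lemma frac_eternally_dominable_remove_leaves:
  assumes G: "pair_graph G" and L: "\<And>l. l \<in> L \<Longrightarrow> nbhd G l = {x}"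
    and l: "l1 \<in> L" "l2 \<in> L" "l1 \<noteq> l2"
    and x: "nbhd G x \<subseteq> insert z L"
    and dom: "frac_eternally_dominable G S"
  shows "frac_eternally_dominable (remove_verts G L) (S - 1)"
proof -
  have Lx: "L \<subseteq> nbhd G x"
    using L nbhd_sym[OF G, of _ x] by blast
  then have LV: "L \<subseteq> pverts G" and xL: "x \<notin> L"
    using nbhd_subset_pverts[OF G] nbhd_irrefl[OF G] by blast+
  have xV: "x \<in> pverts G"
    using L[OF l(1)] nbhd_subset_pverts[OF G] by blast
  have l1x: "l1 \<noteq> x"
    using l(1) xL by blast
  have cl: "closed_nbhd G l1 \<subseteq> insert x L"
    using L[OF l(1)] l(1) by (auto simp: closed_nbhd_def)
  have finL: "finite L"
    using LV finite_pverts[OF G] by (rule finite_subset)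
  show ?thesis
  proof (rule frac_eternally_dominable_absorb[OF G LV, where c = x and y = l1 and b = l2 and S = S])
    fix w assume w: "frac_dominating G w" "1 \<le> w l2"
    have "1 \<le> sum w (closed_nbhd G l1)"
      using w(1) l(1) LV unfolding frac_dominating_def by auto
    then have "1 \<le> w x + w l1"
      using L[OF l(1)] l1x by (simp add: closed_nbhd_def)
    moreover have "w l1 + w l2 \<le> sum w L"
    proof -
      have "sum w {l1, l2} \<le> sum w L"
        using w(1) l LV finL unfolding frac_dominating_def by (intro sum_mono2) auto
      then show ?thesis
        using l(3) by simp
    qed
    ultimately show "2 \<le> w x + sum w L"
      using w(2) by simp
  qed (use L cl l x xV xL LV dom in blast)+
qed

section \<open>Upper bounds for guards\<close>

lemma guard_move_insert:
  assumes "guard_move G D D'" "a \<notin> D" "b \<notin> D'" "b \<in> closed_nbhd G a"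
  shows "guard_move G (insert a D) (insert b D')"
proof -
  obtain \<phi> where \<phi>: "bij_betw \<phi> D D'" "\<And>u. u \<in> D \<Longrightarrow> \<phi> u \<in> closed_nbhd G u"
    using assms(1) unfolding guard_move_def by blast
  have "bij_betw (\<phi>(a := b)) D D'"
    using \<phi>(1) assms(2) by (subst bij_betw_cong[where g = \<phi>]) auto
  then have "bij_betw (\<phi>(a := b)) (insert a D) (insert b D')"
    using assms(2,3) notIn_Un_bij_betw[of a D "\<phi>(a := b)" D'] by simp
  then show ?thesis
    unfolding guard_move_def using \<phi>(2) assms(4) by (intro exI[of _ "\<phi>(a := b)"]) auto
qed

lemma guard_move_refl: "guard_move G D D"
  unfolding guard_move_def by (intro exI[of _ id]) (auto simp: closed_nbhd_def)

lemma guard_move_remove_verts: "guard_move (remove_verts G R) D D' \<Longrightarrow> guard_move G D D'"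
  unfolding guard_move_def closed_nbhd_def nbhd_remove_verts
  by (auto split: if_splits)

lemma m_eternally_dominable_add_clique:
  assumes R: "R \<subseteq> pverts G" "r0 \<in> R"
    and clique: "\<And>r s. r \<in> R \<Longrightarrow> s \<in> R \<Longrightarrow> s \<in> closed_nbhd G r"
    and G: "finite (pverts G)"
    and dom: "m_eternally_dominable (remove_verts G R) k"
  shows "m_eternally_dominable G (Suc k)"
proof -
  obtain P D0 where safe: "m_safe (remove_verts G R) P" and D0: "D0 \<in> P" "card D0 = k"
    using dom unfolding m_eternally_dominable_iff_safe by blast
  have sub: "D \<subseteq> pverts G - R" if "D \<in> P" for D
    using safe that unfolding m_safe_def by auto
  define Q where "Q = {insert r D | r D. r \<in> R \<and> D \<in> P}"
  have "m_safe G Q"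
    unfolding m_safe_def
  proof (intro ballI conjI)
    fix E assume "E \<in> Q"
    then obtain r D where E: "E = insert r D" "r \<in> R" "D \<in> P"
      unfolding Q_def by blast
    then show "E \<subseteq> pverts G"
      using sub R(1) by blast
    fix v assume v: "v \<in> pverts G - E"
    show "\<exists>E'\<in>Q. guard_move G E E' \<and> v \<in> E'"
    proof (cases "v \<in> R")
      case True
      then have "guard_move G E (insert v D)"
        using E sub clique unfolding E(1) by (intro guard_move_insert guard_move_refl) auto
      then show ?thesis
        using E True unfolding Q_def by blast
    next
      case False
      then have "v \<in> pverts (remove_verts G R) - D"
        using v E by simp
      then obtain D' where D': "D' \<in> P" "guard_move (remove_verts G R) D D'" "v \<in> D'"
        using safe E(3) unfolding m_safe_def by meson
      then have "guard_move G E (insert r D')"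
        using E sub clique unfolding E(1)
        by (intro guard_move_insert guard_move_remove_verts[of G R]) auto
      then show ?thesis
        using E D' unfolding Q_def by blast
    qed
  qed
  moreover have "insert r0 D0 \<in> Q"
    using R(2) D0(1) unfolding Q_def by blast
  moreover have "card (insert r0 D0) = Suc k"
    using sub[OF D0(1)] R(2) D0(2) finite_subset[of D0 "pverts G"] G
    by (subst card_insert_disjoint) auto
  ultimately show ?thesis
    unfolding m_eternally_dominable_iff_safe by blast
qed

text \<open>
  To a guard set \<open>D\<close> of the smaller graph belong the sets with one \<open>extra\<close> guard: at \<open>x\<close> if \<open>x\<close> is not
  in \<open>D\<close>, and at any vertex of \<open>L\<close> otherwise. Thus \<open>x\<close> is always occupied, and the extra guard can
  follow any change of \<open>D\<close> at \<open>x\<close> by moving between \<open>x\<close> and \<open>L\<close>. An attack on \<open>L\<close> is answered by the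
  guard at \<open>x\<close>, which must then be replaced: by the extra guard if that one is in \<open>L\<close>, and otherwise
  by the answer of the smaller game to an attack on \<open>x\<close>.
\<close>

lemma m_eternally_dominable_add_leaves:
  assumes G: "pair_graph G" and x: "x \<in> pverts G" and L: "L \<subseteq> nbhd G x" "l0 \<in> L"
    and dom: "m_eternally_dominable (remove_verts G L) k"
  shows "m_eternally_dominable G (Suc k)"
proof -
  let ?H = "remove_verts G L"
  obtain P D0 where safe: "m_safe ?H P" and D0: "D0 \<in> P" "card D0 = k"
    using dom unfolding m_eternally_dominable_iff_safe by blast
  have sub: "D \<subseteq> pverts G - L" if "D \<in> P" for D
    using safe that unfolding m_safe_def by auto
  have LV: "L \<subseteq> pverts G" and xL: "x \<notin> L"
    using L(1) nbhd_subset_pverts[OF G] nbhd_irrefl[OF G] by blast+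
  have adj: "l \<in> closed_nbhd G x" "x \<in> closed_nbhd G l" "x \<in> closed_nbhd G x"
    "l \<in> closed_nbhd G l" if "l \<in> L" for l
    using that L(1) nbhd_sym[OF G, of x l] by (auto simp: closed_nbhd_def)
  define extra where "extra D = (if x \<in> D then L else {x})" for D
  define Q where "Q = {insert e D | e D. D \<in> P \<and> e \<in> extra D}"
  have fresh: "e \<notin> D" if "D \<in> P" "e \<in> extra D" for D e
    using that sub by (auto simp: extra_def split: if_splits)
  have x_in: "x \<in> insert e D" if "e \<in> extra D" for D e
    using that by (auto simp: extra_def split: if_splits)
  have lift: "guard_move G (insert e D) (insert e' D')"
    if "D \<in> P" "e \<in> extra D" "D' \<in> P" "e' \<in> extra D'" "guard_move ?H D D'"
      "e' \<in> closed_nbhd G e" for D e D' e'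
    by (rule guard_move_insert[OF guard_move_remove_verts[OF that(5)]
          fresh[OF that(1,2)] fresh[OF that(3,4)] that(6)])
  have "m_safe G Q"
    unfolding m_safe_def
  proof (intro ballI conjI)
    fix E assume "E \<in> Q"
    then obtain e D where E: "E = insert e D" "D \<in> P" "e \<in> extra D"
      unfolding Q_def by blast
    have "extra D \<subseteq> pverts G"
      using LV x by (simp add: extra_def)
    then show "E \<subseteq> pverts G"
      using sub[OF E(2)] E(1,3) by blast
    fix v assume v: "v \<in> pverts G - E"
    then have vx: "v \<noteq> x"
      using x_in[OF E(3)] E(1) by blast
    show "\<exists>E'\<in>Q. guard_move G E E' \<and> v \<in> E'"
    proof (cases "v \<in> L")
      case vL: True
      show ?thesis
      proof (cases "x \<in> D")
        case True
        then have e: "e \<in> L" "e \<notin> D" "v \<notin> D"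
          using E(3) fresh[OF E(2,3)] v unfolding E(1) by (simp_all add: extra_def)
        \<comment> \<open>Two steps at once: the guard at \<open>e\<close> moves to \<open>x\<close>, and the guard at \<open>x\<close> moves to \<open>v\<close>.\<close>
        have "guard_move G (insert e (D - {x})) (insert x (D - {x}))"
          using e adj by (intro guard_move_insert guard_move_refl) auto
        then have "guard_move G (insert x (insert e (D - {x}))) (insert v (insert x (D - {x})))"
          using e adj vL xL vx by (intro guard_move_insert[where a = x and b = v]) auto
        moreover have "insert x (insert e (D - {x})) = E" "insert v (insert x (D - {x})) = insert v D"
          using True E(1) by auto
        ultimately have "guard_move G E (insert v D)" by simp
        moreover have "insert v D \<in> Q"
          using True vL E(2) unfolding Q_def extra_def by auto
        ultimately show ?thesis by blast
      next
        case False
        then have "x \<in> pverts ?H - D"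
          using x xL by simp
        then obtain D' where D': "D' \<in> P" "guard_move ?H D D'" "x \<in> D'"
          using safe E(2) unfolding m_safe_def by meson
        have "e = x" "v \<in> extra D'"
          using False E(3) D'(3) vL by (auto simp: extra_def)
        then have "guard_move G E (insert v D')"
          unfolding E(1) using lift E D' adj(1)[OF vL] by blast
        then show ?thesis
          using D'(1) \<open>v \<in> extra D'\<close> unfolding Q_def by blast
      qed
    next
      case False
      then have "v \<in> pverts ?H - D"
        using v E(1) by simp
      then obtain D' where D': "D' \<in> P" "guard_move ?H D D'" "v \<in> D'"
        using safe E(2) unfolding m_safe_def by meson
      obtain e' where e': "e' \<in> extra D'" "e' \<in> closed_nbhd G e"
      proof (cases "x \<in> D'")
        case True
        then show ?thesis
          using that[of e] that[of l0] E(3) L(2) adj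
          by (auto simp: extra_def split: if_splits)
      next
        case False
        then show ?thesis
          using that[of x] E(3) L(2) adj by (auto simp: extra_def split: if_splits)
      qed
      then have "guard_move G E (insert e' D')"
        unfolding E(1) using lift E D' by blast
      then show ?thesis
        using D' e'(1) unfolding Q_def by blast
    qed
  qed
  moreover obtain e where e: "e \<in> extra D0"
    using L(2) unfolding extra_def by (cases "x \<in> D0") auto
  then have "insert e D0 \<in> Q"
    using D0(1) unfolding Q_def by blast
  moreover have "card (insert e D0) = Suc k"
    using fresh[OF D0(1) e] D0(2) finite_subset[of D0 "pverts G"] sub[OF D0(1)] finite_pverts[OF G]
    by (subst card_insert_disjoint) auto
  ultimately show ?thesis
    unfolding m_eternally_dominable_iff_safe by blast
qed

section \<open>Ends of acyclic graphs\<close>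

text \<open>
  Cycles of length 2 are disregarded, as every edge traversed back and forth is one.
\<close>

definition acyclic_graph :: "'a pair_pre_digraph \<Rightarrow> bool" where
  "acyclic_graph G \<longleftrightarrow>
     pair_graph G \<and> \<not> (\<exists>p. pre_digraph.cycle (with_proj G) p \<and> 3 \<le> length p)"

lemma acyclic_graph_remove_verts:
  assumes "acyclic_graph G"
  shows "acyclic_graph (remove_verts G R)"
proof -
  have G: "pair_graph G"
    using assms by (simp add: acyclic_graph_def)
  interpret pair_graph G by fact
  interpret H: pair_graph "remove_verts G R"
    using G by (rule pair_graph_remove_verts)
  have "subgraph (with_proj (remove_verts G R)) (with_proj G)"
    using H.wf_digraph_axioms wf_digraph_axioms
    by (auto simp: subgraph_def remove_verts_def compatible_def)
  then show ?thesis
    using assms H.pair_graph subgraph_cycle unfolding acyclic_graph_def by blast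
qed

lemma awalk_vwalk_arcs:
  assumes "pair_graph G" "vwalk (u # xs) (with_proj G)"
  shows "pre_digraph.awalk (with_proj G) u (vwalk_arcs (u # xs)) (last (u # xs)) \<and>
    pawalk_verts u (vwalk_arcs (u # xs)) = u # xs"
  using assms(2)
proof (induction xs arbitrary: u)
  case Nil
  interpret pair_graph G by fact
  show ?case using Nil by (auto simp: vwalk_def awalk_Nil_iff)
next
  case (Cons v xs)
  interpret pair_graph G by fact
  show ?case using Cons by (auto simp: vwalk_def awalk_Cons_iff)
qed

lemma acyclic_graph_chord:
  assumes G: "acyclic_graph G" and path: "vpath (a # b # xs) (with_proj G)"
    and u: "u \<in> set xs"
  shows "u \<notin> nbhd G a"
proof
  assume adj: "u \<in> nbhd G a"
  have pg: "pair_graph G"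
    using G by (simp add: acyclic_graph_def)
  interpret pair_graph G by fact
  obtain as bs where xs: "xs = as @ u # bs"
    using u by (auto simp: in_set_conv_decomp)
  let ?c = "a # b # as @ [u]"
  have "vwalk (?c @ bs) (with_proj G)"
    using path xs by (simp add: vpath_def)
  then have c: "vwalk ?c (with_proj G)"
    by (rule vwalkI_append_l[rotated]) simp
  have "(u, a) \<in> parcs G" "a \<in> pverts G"
    using adj arcs_symmetric in_arcsD1 by (auto simp: nbhd_def)
  then have "vwalk (?c @ [a]) (with_proj G)"
    using c vwalk_arcs_append[of ?c "[a]"] by (simp add: vwalk_def)
  then have walk: "awalk a (vwalk_arcs (?c @ [a])) a"
    "pawalk_verts a (vwalk_arcs (?c @ [a])) = ?c @ [a]"
    using awalk_vwalk_arcs[OF pg, of a "b # as @ [u, a]"] by simp_all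
  have "distinct (tl (?c @ [a]))"
    using path xs by (auto simp: vpath_def)
  with walk have "cycle (vwalk_arcs (?c @ [a]))"
    unfolding cycle_def by (intro exI[of _ a]) auto
  moreover have "3 \<le> length (vwalk_arcs (?c @ [a]))"
    using vwalk_length_simp[of "?c @ [a]"] unfolding vwalk_length_def
    by (simp del: vwalk_arcs_Cons vwalk_arcs.simps)
  ultimately show False
    using G unfolding acyclic_graph_def by blast
qed

lemma vpath_Cons:
  assumes G: "pair_graph G" and "vpath (v # xs) (with_proj G)" "u \<in> nbhd G v" "u \<notin> set (v # xs)"
  shows "vpath (u # v # xs) (with_proj G)"
  using assms nbhd_subset_pverts[OF G] nbhd_sym[OF G, of u v]
  by (auto simp: vpath_def vwalk_def nbhd_def)

text \<open>
  All neighbours of the first vertex of a longest path lie on the path, and by acyclicity only the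
  second vertex can be one. The second vertex \<open>x\<close> likewise has no neighbours farther down the path
  than the third vertex \<open>z\<close>, and a neighbour off the path can replace the first vertex, so it
  is a leaf as well.
\<close>

lemma acyclic_graph_end:
  assumes G: "acyclic_graph G" and ne: "pverts G \<noteq> {}"
  obtains v where "v \<in> pverts G" "nbhd G v = {}"
  | x l z where "nbhd G l = {x}" "\<And>u. u \<in> nbhd G x \<Longrightarrow> u \<noteq> z \<Longrightarrow> nbhd G u = {x}"
proof -
  have pg: "pair_graph G"
    using G by (simp add: acyclic_graph_def)
  let ?path = "\<lambda>xs. vpath xs (with_proj G)"
  obtain v where v: "v \<in> pverts G"
    using ne by blast
  have "?path [v]"
    using v by (auto simp: vpath_def vwalk_def)
  moreover have "length xs \<le> card (pverts G)" if "?path xs" for xs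
    using that card_mono[OF finite_pverts[OF pg], of "set xs"] distinct_card[of xs]
    by (auto simp: vpath_def vwalk_def)
  ultimately obtain p where p: "?path p" and max: "\<And>q. ?path q \<Longrightarrow> length q \<le> length p"
    using ex_has_greatest_nat[of ?path "[v]" length "Suc (card (pverts G))"]
    by (metis le_imp_less_Suc)
  have end_nbhd: "nbhd G a \<subseteq> {b}" if "?path (a # b # xs)" "length (a # b # xs) = length p" for a b xs
  proof
    fix u assume u: "u \<in> nbhd G a"
    have "u \<in> set (a # b # xs)"
      using vpath_Cons[OF pg that(1) u] max[of "u # a # b # xs"] that(2) by auto
    moreover have "u \<noteq> a"
      using u nbhd_irrefl[OF pg] by blast
    moreover have "u \<notin> set xs"
      using acyclic_graph_chord[OF G that(1)] u by blast
    ultimately show "u \<in> {b}" by simp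
  qed
  obtain a ys where p_eq: "p = a # ys"
    using p by (cases p) (auto simp: vpath_def vwalk_def)
  show thesis
  proof (cases ys)
    case Nil
    have "a \<in> pverts G"
      using p p_eq by (auto simp: vpath_def vwalk_def)
    moreover have "nbhd G a = {}"
      using vpath_Cons[OF pg, of a "[]"] max p nbhd_irrefl[OF pg, of a] unfolding p_eq Nil by fastforce
    ultimately show thesis by (rule that(1))
  next
    case (Cons b xs)
    have ab: "b \<in> nbhd G a"
      using p p_eq Cons by (auto simp: vpath_def vwalk_def nbhd_def)
    have leaf_a: "nbhd G a = {b}"
      using end_nbhd[of a b xs] p p_eq Cons ab by auto
    have path_b: "?path (b # xs)"
      using p p_eq Cons by (auto simp: vpath_def vwalk_def)
    \<comment> \<open>On a path with just two vertices, all neighbours of \<open>b\<close> are leaves, so excepting \<open>a\<close> is harmless.\<close>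
    show thesis
    proof (rule that(2)[OF leaf_a])
      fix u assume u: "u \<in> nbhd G b" "u \<noteq> (if xs = [] then a else hd xs)"
      have "u \<notin> set xs"
      proof (cases xs)
        case (Cons c zs)
        then show ?thesis
          using u acyclic_graph_chord[OF G, of b c zs u] path_b by auto
      qed simp
      moreover have "u \<noteq> b"
        using u nbhd_irrefl[OF pg] by blast
      ultimately have "?path (u # b # xs)"
        using vpath_Cons[OF pg path_b u(1)] by simp
      then have "nbhd G u \<subseteq> {b}"
        using end_nbhd[of u b xs] p_eq Cons by simp
      then show "nbhd G u = {b}"
        using u(1) nbhd_sym[OF pg, of u b] by blast
    qed
  qed
qed

section \<open>Equality of the two parameters\<close>

text \<open>
  The bounds by guards from above and by weights from below are carried along together, since each
  of the reductions raises both by 1.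
\<close>

theorem forest_eternal_domination:
  assumes "acyclic_graph G"
  shows "\<exists>n. m_eternally_dominable G n \<and> (\<forall>S. frac_eternally_dominable G S \<longrightarrow> real n \<le> S)"
  using assms
proof (induction "card (pverts G)" arbitrary: G rule: less_induct)
  case less
  have pg: "pair_graph G"
    using less.prems by (simp add: acyclic_graph_def)
  have reduce: ?case
    if R: "R \<subseteq> pverts G" "R \<noteq> {}"
      and m: "\<And>k. m_eternally_dominable (remove_verts G R) k \<Longrightarrow> m_eternally_dominable G (Suc k)"
      and f: "\<And>S. frac_eternally_dominable G S \<Longrightarrow>
        frac_eternally_dominable (remove_verts G R) (S - 1)" for R
  proof -
    have "card (pverts (remove_verts G R)) < card (pverts G)"
      using R finite_pverts[OF pg] by (auto intro!: psubset_card_mono)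
    then obtain n where n: "m_eternally_dominable (remove_verts G R) n"
      "\<And>S. frac_eternally_dominable (remove_verts G R) S \<Longrightarrow> real n \<le> S"
      using less.hyps acyclic_graph_remove_verts[OF less.prems] by blast
    then have "real (Suc n) \<le> S" if "frac_eternally_dominable G S" for S
      using f[OF that] by fastforce
    then show ?thesis
      using m[OF n(1)] by blast
  qed
  have remove_end: ?case
    if R: "R \<subseteq> pverts G" "y \<in> R" "nbhd G y \<subseteq> R"
      and nb: "\<And>r. r \<in> R \<Longrightarrow> nbhd G r \<subseteq> insert z R"
      and clique: "\<And>r s. r \<in> R \<Longrightarrow> s \<in> R \<Longrightarrow> s \<in> closed_nbhd G r" for R y z
  proof (rule reduce[OF R(1)])
    show "m_eternally_dominable G (Suc k)" if "m_eternally_dominable (remove_verts G R) k" for k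
      using m_eternally_dominable_add_clique[OF R(1,2) clique finite_pverts[OF pg] that] .
    show "frac_eternally_dominable (remove_verts G R) (S - 1)"
      if "frac_eternally_dominable G S" for S
      using frac_eternally_dominable_remove_end[OF pg R nb that] .
  qed (use R in auto)
  show ?case
  proof (cases "pverts G = {}")
    case True
    have "m_eternally_dominable G 0"
      using m_eternally_dominable_card[of G] True by simp
    moreover have "0 \<le> S" if "frac_eternally_dominable G S" for S
      using that True unfolding frac_eternally_dominable_def by simp
    ultimately show ?thesis by force
  next
    case False
    show ?thesis
    proof (rule acyclic_graph_end[OF less.prems False])
      fix v assume "v \<in> pverts G" "nbhd G v = {}"
      then show ?thesis
        using remove_end[of "{v}" v] by (auto simp: closed_nbhd_def)
    next
      fix x l z
      assume l: "nbhd G l = {x}" and z: "\<And>u. u \<in> nbhd G x \<Longrightarrow> u \<noteq> z \<Longrightarrow> nbhd G u = {x}"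
      define L where "L = {u. nbhd G u = {x}}"
      have lx: "l \<in> nbhd G x" "x \<in> nbhd G l"
        using l nbhd_sym[OF pg, of l x] by auto
      have V: "l \<in> pverts G" "x \<in> pverts G"
        using lx nbhd_subset_pverts[OF pg] by blast+
      have Lx: "L \<subseteq> nbhd G x"
        unfolding L_def using nbhd_sym[OF pg, of _ x] by blast
      have xL: "nbhd G x \<subseteq> insert z L"
        unfolding L_def using z by blast
      show ?thesis
      proof (cases "L = {l}")
        case True
        show ?thesis
          using remove_end[of "{l, x}" l z] V l lx xL True by (auto simp: closed_nbhd_def)
      next
        case False
        then obtain l' where l': "l' \<in> L" "l' \<noteq> l" and lL: "l \<in> L"
          using l unfolding L_def by blast
        show ?thesis
        proof (rule reduce)
          show "m_eternally_dominable G (Suc k)" if "m_eternally_dominable (remove_verts G L) k" for k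
            using m_eternally_dominable_add_leaves[OF pg V(2) Lx lL that] .
          show "frac_eternally_dominable (remove_verts G L) (S - 1)"
            if "frac_eternally_dominable G S" for S
            using frac_eternally_dominable_remove_leaves[OF pg _ lL l'(1) l'(2)[symmetric] xL that]
            unfolding L_def by blast
        qed (use lL Lx nbhd_subset_pverts[OF pg] in blast)+
      qed
    qed
  qed
qed

theorem proposition4p4:
  fixes T :: "'a pair_pre_digraph"
  assumes "undirected_tree T"
  shows "frac_eternal_domination_number T = real (m_eternal_domination_number T)"
proof -
  have T: "acyclic_graph T" "pair_graph T"
    using assms by (auto simp: undirected_tree_def acyclic_graph_def)
  obtain n where n: "m_eternally_dominable T n"
    "\<And>S. frac_eternally_dominable T S \<Longrightarrow> real n \<le> S"
    using forest_eternal_domination[OF T(1)] by blast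
  have "n \<le> k" if "m_eternally_dominable T k" for k
    using n(2)[OF m_imp_frac_eternally_dominable[OF T(2) that]] by simp
  then have "m_eternal_domination_number T = n"
    unfolding m_eternal_domination_number_def using n(1) by (intro Least_equality)
  moreover have "frac_eternal_domination_number T = real n"
    unfolding frac_eternal_domination_number_def
    using n m_imp_frac_eternally_dominable[OF T(2)] by (intro cInf_eq_minimum) auto
  ultimately show ?thesis by simp
qed

end
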